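(* Let $q$ be a prime power and $a,b,d,u$ integers with $2\le d\le\min\{a,b\}$ and $0\le u$. Then $\Lambda(q,a,b,d,u)\le\Lambda(q,a,b-1,d-1,u)$ and $$\Lambda(q,a,b,d,u)\le\sum_{r=0}^{\min\{u,\min\{a,b\}-d+1\}}q^{\binom r2}(q-1)^r[r]_q!\binom{\min\{a,b\}-d+1}{r}_q\binom{\max\{a,b\}}{r}_q.$$
   Context: $\Lambda(q,a,b,d,u)$ is the maximum size of a set of $a\times b$ matrices over $\mathbb{F}_q$ such that any two distinct elements $X,Y$ satisfy $\mathrm{rk}(X-Y)\ge d$ and every element has rank at most $u$. $[n]_q=(q^n-1)/(q-1)$, $[r]_q!=\prod_{i=1}^r[i]_q$ (with $[0]_q!=1$), and $\binom{n}{k}_q=\prod_{i=0}^{k-1}\frac{q^n-q^i}{q^k-q^i}$. *)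

theory Defs
  imports
    "HOL-Library.Cardinality"
    "HOL-Number_Theory.Prime_Powers"
    "Jordan_Normal_Form.DL_Rank"
begin

definition rank_codes :: "'f::{field,finite} itself \<Rightarrow> nat \<Rightarrow> nat \<Rightarrow> nat \<Rightarrow> nat \<Rightarrow> 'f mat set set"
  where "rank_codes F a b d u =
    {C. C \<subseteq> carrier_mat a b
      \<and> (\<forall>X\<in>C. \<forall>Y\<in>C. X \<noteq> Y \<longrightarrow> d \<le> vec_space.rank a (X - Y))
      \<and> (\<forall>X\<in>C. vec_space.rank a X \<le> u)}"

text \<open>The parameter \<open>q\<close> is carried by the finite field type \<open>'f\<close>, as \<open>q = CARD('f)\<close>.\<close>

definition Lambda :: "'f::{field,finite} itself \<Rightarrow> nat \<Rightarrow> nat \<Rightarrow> nat \<Rightarrow> nat \<Rightarrow> nat"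
  where "Lambda F a b d u = Max (card ` rank_codes F a b d u)"

definition q_int :: "nat \<Rightarrow> nat \<Rightarrow> real"
  where "q_int q n = (real q ^ n - 1) / (real q - 1)"

definition q_fact :: "nat \<Rightarrow> nat \<Rightarrow> real"
  where "q_fact q r = (\<Prod>i=1..r. q_int q i)"

definition q_binomial :: "nat \<Rightarrow> nat \<Rightarrow> nat \<Rightarrow> real"
  where "q_binomial q n k =
    (\<Prod>i<k. (real q ^ n - real q ^ i) / (real q ^ k - real q ^ i))"

text \<open>The maximum in \<^const>\<open>Lambda\<close> ranges over a finite nonempty set, so it is attained.\<close>

lemma finite_carrier_mat: "finite (carrier_mat a b :: 'f::finite mat set)"
proof (rule finite_subset)
  let ?I = "{..<a} \<times> {..<b}"
  show "carrier_mat a b \<subseteq> (\<lambda>f. mat a b f :: 'f mat) ` (?I \<rightarrow>\<^sub>E UNIV)"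
  proof
    fix A :: "'f mat" assume "A \<in> carrier_mat a b"
    then have "A = mat a b (restrict (\<lambda>p. A $$ p) ?I)" by (intro eq_matI) auto
    then show "A \<in> (\<lambda>f. mat a b f) ` (?I \<rightarrow>\<^sub>E UNIV)"
      by (rule image_eqI[where x = "restrict (\<lambda>p. A $$ p) ?I"]) simp
  qed
  show "finite ((\<lambda>f. mat a b f :: 'f mat) ` (?I \<rightarrow>\<^sub>E UNIV))"
    by (intro finite_imageI finite_PiE) auto
qed

lemma finite_rank_codes: "finite (rank_codes F a b d u)"
  by (rule finite_subset[of _ "Pow (carrier_mat a b)"])
    (auto simp: rank_codes_def finite_carrier_mat)

lemma Lambda_attained: "\<exists>C\<in>rank_codes F a b d u. card C = Lambda F a b d u"
proof -
  have "{} \<in> rank_codes F a b d u" by (simp add: rank_codes_def)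
  then have "Lambda F a b d u \<in> card ` rank_codes F a b d u"
    unfolding Lambda_def by (intro Max_in finite_imageI finite_rank_codes) auto
  then show ?thesis by auto
qed

lemma card_le_Lambda: "C \<in> rank_codes F a b d u \<Longrightarrow> card C \<le> Lambda F a b d u"
  unfolding Lambda_def by (intro Max_ge finite_imageI finite_rank_codes imageI)

end

theory Submission
  imports Defs "Berlekamp_Zassenhaus.Berlekamp_Type_Based"
begin

text \<open>Deleting the last column lowers the rank by at most one and never raises it, so it maps a code
  of minimum distance \<open>d \<ge> 2\<close> injectively to one of minimum distance at least \<open>d - 1\<close> with the same
  rank bound. Ranks are invariant under transposition, so the shorter side may be taken to be the
  row length, and deleting \<open>d - 1\<close> columns leaves a set of matrices of rank at most \<open>u\<close>. The number
  of matrices of rank \<open>r\<close> is found by appending columns: \<open>A\<close> keeps its rank for the \<open>q ^ rank A\<close>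
  columns in its column space and gains one otherwise, a recursion that matches the \<open>q\<close>-Pascal
  rule.\<close>

subsection \<open>Dimension and rank over a field\<close>

lemma (in vectorspace) card_carrier_eq_power_dim:
  assumes "fin_dim"
  shows "card (carrier V) = card (carrier K) ^ dim"
proof -
  obtain B where B: "finite B" "basis B"
    using finite_basis_exists[OF assms] by blast
  have sub: "B \<subseteq> carrier V"
    using B(2) by (simp add: basis_def)
  have coord: "\<exists>!a. a \<in> B \<rightarrow>\<^sub>E carrier K \<and> lincomb a B = v" if "v \<in> carrier V" for v
    using basis_criterion[OF B(1) sub] B(2) that by blast
  have closed: "lincomb a B \<in> carrier V" if "a \<in> B \<rightarrow>\<^sub>E carrier K" for a
    using that sub by (intro lincomb_closed) auto
  have "bij_betw (\<lambda>a. lincomb a B) (B \<rightarrow>\<^sub>E carrier K) (carrier V)"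
    unfolding bij_betw_def
  proof
    show "inj_on (\<lambda>a. lincomb a B) (B \<rightarrow>\<^sub>E carrier K)"
    proof (rule inj_onI)
      fix a b assume "a \<in> B \<rightarrow>\<^sub>E carrier K" "b \<in> B \<rightarrow>\<^sub>E carrier K" "lincomb a B = lincomb b B"
      then show "a = b"
        using coord[OF closed[of b]] by auto
    qed
    show "(\<lambda>a. lincomb a B) ` (B \<rightarrow>\<^sub>E carrier K) = carrier V"
    proof (intro equalityI subsetI)
      fix v assume "v \<in> carrier V"
      then show "v \<in> (\<lambda>a. lincomb a B) ` (B \<rightarrow>\<^sub>E carrier K)"
        using coord[of v] by auto
    qed (auto simp only: closed)
  qed
  then have "card (carrier V) = card (B \<rightarrow>\<^sub>E carrier K)"
    by (simp add: bij_betw_same_card)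
  also have "\<dots> = card (carrier K) ^ dim"
    using B by (simp add: card_PiE dim_basis)
  finally show ?thesis .
qed

lemma (in vectorspace) dim_span_insert:
  assumes S: "finite S" "S \<subseteq> carrier V" and v: "v \<in> carrier V" "v \<notin> span S"
  shows "vectorspace.dim K (span_vs (insert v S)) = Suc (vectorspace.dim K (span_vs S))"
proof -
  obtain U where U: "finite U" "maximal U (\<lambda>T. T \<subseteq> S \<and> lin_indpt T)"
    using maximal_exists_superset[of S "\<lambda>T. T \<subseteq> S \<and> lin_indpt T" "{}"] S(1)
    by (auto simp: finite_lin_indpt2)
  then have US: "U \<subseteq> S" and indpt: "lin_indpt U"
    by (auto simp: maximal_def)
  have vU: "v \<notin> span U" "v \<notin> U"
    using v span_is_monotone[OF US] in_own_span[OF S(2)] US by auto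
  have "lin_indpt (insert v U)"
    using lin_dep_iff_in_span[OF _ indpt v(1) vU(2)] US S(2) vU(1) by auto
  moreover have "T = insert v U" if "insert v U \<subseteq> T" "T \<subseteq> insert v S" "lin_indpt T" for T
  proof -
    have "T - {v} \<subseteq> S" "lin_indpt (T - {v})" "U \<subseteq> T - {v}"
      using that subset_li_is_li[of T "T - {v}"] vU(2) by auto
    then have "T - {v} = U"
      using U(2) unfolding maximal_def by blast
    then show ?thesis
      using that(1) by blast
  qed
  ultimately have "maximal (insert v U) (\<lambda>T. T \<subseteq> insert v S \<and> lin_indpt T)"
    unfolding maximal_def using US by blast
  then have "vectorspace.dim K (span_vs (insert v S)) = card (insert v U)"
    using S v by (intro dim_span) auto
  then show ?thesis
    using dim_span[OF S(2,1) U(2)] U(1) vU(2) by simp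
qed

lemma (in vec_space) rank_mono_col_space:
  assumes A: "A \<in> carrier_mat n k" and B: "B \<in> carrier_mat n l"
    and sub: "col_space A \<subseteq> col_space B"
  shows "rank A \<le> rank B"
proof -
  have cols: "set (cols A) \<subseteq> carrier_vec n" "set (cols B) \<subseteq> carrier_vec n"
    using A B cols_dim by blast+
  interpret B: vectorspace class_ring "span_vs (set (cols B))"
    by (intro subspace_is_vs span_is_subspace) (simp add: cols)
  have "subspace class_ring (span (set (cols A))) (span_vs (set (cols B)))"
    using sub cols by (intro nested_subspaces span_is_subspace) (simp_all add: col_space_def)
  then show ?thesis
    using B.subspace_dim fin_dim_span_cols[OF A] fin_dim_span_cols[OF B] by (simp add: rank_def)
qed

lemma (in vec_space) rank_mult_le_left:
  assumes A: "A \<in> carrier_mat n k" and B: "B \<in> carrier_mat k l"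
  shows "rank (A * B) \<le> rank A"
proof (rule rank_mono_col_space)
  show "col_space (A * B) \<subseteq> col_space A"
  proof
    fix y assume "y \<in> col_space (A * B)"
    then obtain x where x: "x \<in> carrier_vec l" "y = A * B *\<^sub>v x"
      using col_space_eq[of "A * B" l] A B by auto
    then have "y = A *\<^sub>v (B *\<^sub>v x)"
      using A B by simp
    then show "y \<in> col_space A"
      using col_space_eq[OF A] A B x(1) by auto
  qed
qed (use A B in auto)

lemma (in vec_space) col_space_basis_mat:
  assumes A: "A \<in> carrier_mat n k"
  obtains B where "B \<in> carrier_mat n (rank A)" "col_space B = col_space A"
proof -
  have cols: "set (cols A) \<subseteq> carrier_vec n"
    using A cols_dim by blast
  interpret W: vectorspace class_ring "span_vs (set (cols A))"
    by (intro subspace_is_vs span_is_subspace) (simp add: cols)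
  obtain U where U: "finite U" "W.basis U"
    using W.finite_basis_exists[OF fin_dim_span_cols[OF A]] by blast
  have span_U: "U \<subseteq> span (set (cols A))" "span U = span (set (cols A))"
    using U(2) span_li_not_depend(1)[OF _ span_is_submodule] cols by (auto simp: W.basis_def)
  obtain us where us: "set us = U" "distinct us"
    using finite_distinct_list[OF U(1)] by blast
  have "length us = rank A"
    using U us W.dim_basis distinct_card by (fastforce simp: rank_def)
  then have "mat_of_cols n us \<in> carrier_mat n (rank A)"
    using mat_of_cols_carrier(1)[of n us] by simp
  moreover have "set us \<subseteq> carrier_vec n"
    using span_U(1) us(1) span_is_subset2 cols by auto
  then have "col_space (mat_of_cols n us) = col_space A"
    using span_U(2) us(1) by (simp add: col_space_def)
  ultimately show thesis
    using that by blast
qed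

lemma (in vec_space) col_space_subset_imp_factor:
  assumes A: "A \<in> carrier_mat n k" and B: "B \<in> carrier_mat n l"
    and sub: "col_space A \<subseteq> col_space B"
  obtains C where "C \<in> carrier_mat l k" "A = B * C"
proof -
  have "\<exists>x. x \<in> carrier_vec l \<and> B *\<^sub>v x = col A j" if "j < k" for j
  proof -
    have "col A j = A *\<^sub>v unit_vec k j"
      using A that by (intro eq_vecI) auto
    then have "col A j \<in> col_space A"
      using col_space_eq[OF A] A that by auto
    then show ?thesis
      using sub col_space_eq[OF B] B by auto
  qed
  then obtain x where x: "x j \<in> carrier_vec l" "B *\<^sub>v x j = col A j" if "j < k" for j
    by metis
  let ?C = "mat_of_cols l (map x [0..<k])"
  have C: "?C \<in> carrier_mat l k"
    using mat_of_cols_carrier(1)[of l "map x [0..<k]"] by simp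
  moreover have "A = B * ?C"
  proof (rule mat_col_eqI)
    fix j assume "j < dim_col (B * ?C)"
    then have j: "j < k"
      using C by simp
    show "col A j = col (B * ?C) j"
      using col_mult2[OF B C j] x[OF j] j by simp
  qed (use A B C in auto)
  ultimately show thesis
    using that by blast
qed

lemma (in vec_space) rank_factorization:
  assumes A: "A \<in> carrier_mat n k"
  obtains B C where "B \<in> carrier_mat n (rank A)" "C \<in> carrier_mat (rank A) k" "A = B * C"
proof -
  obtain B where B: "B \<in> carrier_mat n (rank A)" "col_space B = col_space A"
    using col_space_basis_mat[OF A] .
  then obtain C where "C \<in> carrier_mat (rank A) k" "A = B * C"
    using col_space_subset_imp_factor[OF A] by blast
  with B(1) show thesis
    by (rule that)
qed

lemma (in vec_space) rank_eq_0_iff: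
  assumes A: "A \<in> carrier_mat n k"
  shows "rank A = 0 \<longleftrightarrow> A = 0\<^sub>m n k"
proof
  assume rank: "rank A = 0"
  obtain B C where "B \<in> carrier_mat n (rank A)" "C \<in> carrier_mat (rank A) k" and A_eq: "A = B * C"
    using rank_factorization[OF A] .
  then have "B * C = 0\<^sub>m n k"
    unfolding rank by (intro eq_matI) (auto simp: scalar_prod_def)
  then show "A = 0\<^sub>m n k"
    unfolding A_eq .
qed (simp add: rank_0I)

lemma rank_transpose_le:
  fixes A :: "'a::field mat"
  assumes A: "A \<in> carrier_mat m n"
  shows "vec_space.rank n A\<^sup>T \<le> vec_space.rank m A"
proof -
  obtain B C where BC: "B \<in> carrier_mat m (vec_space.rank m A)"
      "C \<in> carrier_mat (vec_space.rank m A) n" "A = B * C"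
    using vec_space.rank_factorization[OF A] .
  have "A\<^sup>T = C\<^sup>T * B\<^sup>T"
    using transpose_mult[OF BC(1,2)] BC(3) by metis
  then have "vec_space.rank n A\<^sup>T \<le> vec_space.rank n C\<^sup>T"
    using vec_space.rank_mult_le_left[of "C\<^sup>T" n _ "B\<^sup>T" m] BC(1,2) by simp
  also have "\<dots> \<le> vec_space.rank m A"
    using BC(2) by (intro vec_space.rank_le_nc) simp
  finally show ?thesis .
qed

lemma rank_transpose:
  fixes A :: "'a::field mat"
  assumes A: "A \<in> carrier_mat m n"
  shows "vec_space.rank n A\<^sup>T = vec_space.rank m A"
  using rank_transpose_le[OF A] rank_transpose_le[of "A\<^sup>T" n m] A by simp

lemma (in vec_space) col_space_subset_carrier:
  assumes "A \<in> carrier_mat n k"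
  shows "col_space A \<subseteq> carrier_vec n"
  using col_space_eq[OF assms] assms by auto

lemma card_col_space:
  fixes A :: "'f::{field,finite} mat"
  assumes A: "A \<in> carrier_mat m n"
  shows "card (vec_space.col_space m A) = CARD('f) ^ vec_space.rank m A"
proof -
  interpret vec_space "TYPE('f)" m .
  interpret W: vectorspace class_ring "span_vs (set (cols A))"
    using A cols_dim by (intro subspace_is_vs span_is_subspace) fastforce
  show ?thesis
    using W.card_carrier_eq_power_dim fin_dim_span_cols[OF A]
    by (simp add: col_space_def rank_def class_ring_simps)
qed

lemma finite_col_space:
  fixes A :: "'f::{field,finite} mat"
  assumes "A \<in> carrier_mat m n"
  shows "finite (vec_space.col_space m A)"
  using vec_space.col_space_subset_carrier[OF assms] by (rule finite_subset) simp

lemma card_carrier_vec_minus_col_space: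
  fixes A :: "'f::{field,finite} mat"
  assumes A: "A \<in> carrier_mat m n"
  shows "real (card (carrier_vec m - vec_space.col_space m A))
    = real CARD('f) ^ m - real CARD('f) ^ vec_space.rank m A"
proof -
  have sub: "vec_space.col_space m A \<subseteq> carrier_vec m"
    by (rule vec_space.col_space_subset_carrier[OF A])
  then have "card (vec_space.col_space m A) \<le> card (carrier_vec m :: 'f vec set)"
    by (simp add: card_mono)
  then show ?thesis
    using card_Diff_subset[OF finite_col_space[OF A] sub]
    by (simp add: of_nat_diff card_col_space[OF A] card_carrier_vec)
qed

subsection \<open>Appending and deleting the last column\<close>

definition append_col :: "'a mat \<Rightarrow> 'a vec \<Rightarrow> 'a mat" where
  "append_col A v = mat_of_cols (dim_row A) (cols A @ [v])"

definition delete_last_col :: "'a mat \<Rightarrow> 'a mat" where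
  "delete_last_col A = mat_of_cols (dim_row A) (butlast (cols A))"

lemma append_col_carrier [simp]:
  assumes "A \<in> carrier_mat m n"
  shows "append_col A v \<in> carrier_mat m (Suc n)"
  using mat_of_cols_carrier(1)[of m "cols A @ [v]"] assms by (simp add: append_col_def)

lemma delete_last_col_carrier [simp]:
  assumes "A \<in> carrier_mat m (Suc n)"
  shows "delete_last_col A \<in> carrier_mat m n"
  using mat_of_cols_carrier(1)[of m "butlast (cols A)"] assms by (simp add: delete_last_col_def)

lemma cols_append_col:
  assumes "A \<in> carrier_mat m n" "v \<in> carrier_vec m"
  shows "cols (append_col A v) = cols A @ [v]"
proof -
  have "set (cols A @ [v]) \<subseteq> carrier_vec (dim_row A)"
    using assms cols_dim[of A] by simp
  then show ?thesis
    unfolding append_col_def by (rule cols_mat_of_cols)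
qed

lemma cols_delete_last_col: "cols (delete_last_col A) = butlast (cols A)"
  unfolding delete_last_col_def
  using cols_dim in_set_butlastD by (intro cols_mat_of_cols) fastforce

lemma append_col_delete_last_col:
  assumes "A \<in> carrier_mat m (Suc n)"
  shows "append_col (delete_last_col A) (col A n) = A"
proof -
  have "last (cols A) = col A n" "cols A \<noteq> []"
    using assms by (simp_all add: last_conv_nth flip: length_greater_0_conv)
  then have "butlast (cols A) @ [col A n] = cols A"
    using append_butlast_last_id[of "cols A"] by metis
  moreover have "dim_row (delete_last_col A) = dim_row A"
    by (simp add: delete_last_col_def)
  ultimately show ?thesis
    by (simp add: append_col_def cols_delete_last_col)
qed

lemma delete_last_col_append_col:
  assumes "A \<in> carrier_mat m n" "v \<in> carrier_vec m"
  shows "delete_last_col (append_col A v) = A"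
proof -
  have "dim_row (append_col A v) = dim_row A"
    by (simp add: append_col_def)
  then show ?thesis
    by (simp add: delete_last_col_def cols_append_col[OF assms])
qed

lemma delete_last_col_minus:
  assumes "A \<in> carrier_mat m n" "B \<in> carrier_mat m n"
  shows "delete_last_col (A - B) = delete_last_col A - delete_last_col B"
proof (rule eq_matI)
  fix i j assume "i < dim_row (delete_last_col A - delete_last_col B)"
    and "j < dim_col (delete_last_col A - delete_last_col B)"
  then have "i < m" "j < n - 1"
    using assms by (auto simp: delete_last_col_def)
  then show "delete_last_col (A - B) $$ (i, j) = (delete_last_col A - delete_last_col B) $$ (i, j)"
    using assms by (simp add: delete_last_col_def mat_of_cols_index nth_butlast)
qed (use assms in \<open>simp_all add: delete_last_col_def\<close>)

lemma bij_betw_append_col: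
  "bij_betw (\<lambda>(A, v). append_col A v) (carrier_mat m n \<times> carrier_vec m) (carrier_mat m (Suc n))"
proof (rule bij_betwI[where g = "\<lambda>A. (delete_last_col A, col A n)"])
  fix x :: "'a mat \<times> 'a vec" assume "x \<in> carrier_mat m n \<times> carrier_vec m"
  then obtain A v where x: "x = (A, v)" "A \<in> carrier_mat m n" "v \<in> carrier_vec m"
    by blast
  have "col (append_col A v) n = v"
    using x by (intro eq_vecI) (auto simp: append_col_def mat_of_cols_index nth_append)
  then show "(delete_last_col (case x of (A, v) \<Rightarrow> append_col A v),
      col (case x of (A, v) \<Rightarrow> append_col A v) n) = x"
    using x by (simp add: delete_last_col_append_col)
qed (auto simp: append_col_delete_last_col)

lemma (in vec_space) rank_append_col:
  assumes A: "A \<in> carrier_mat n k" and v: "v \<in> carrier_vec n"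
  shows "rank (append_col A v) = (if v \<in> col_space A then rank A else Suc (rank A))"
proof -
  let ?S = "set (cols A)"
  have S: "?S \<subseteq> carrier_vec n"
    using A cols_dim by blast
  have cols: "set (cols (append_col A v)) = insert v ?S"
    by (simp add: cols_append_col[OF A v])
  show ?thesis
  proof (cases "v \<in> span ?S")
    case True
    then have "span (insert v ?S) = span ?S"
      using already_in_span[OF S] by simp
    then show ?thesis
      using True by (simp add: cols rank_def col_space_def)
  next
    case False
    then show ?thesis
      using dim_span_insert[of ?S v] S v by (simp add: cols rank_def col_space_def)
  qed
qed

lemma (in vec_space) rank_delete_last_col_bounds:
  assumes A: "A \<in> carrier_mat n (Suc k)"
  shows "rank (delete_last_col A) \<le> rank A" "rank A \<le> Suc (rank (delete_last_col A))"
proof -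
  have "col A k \<in> carrier_vec n"
    using A by auto
  then have "rank A = (if col A k \<in> col_space (delete_last_col A)
      then rank (delete_last_col A) else Suc (rank (delete_last_col A)))"
    using rank_append_col[OF delete_last_col_carrier[OF A], of "col A k"]
    by (simp add: append_col_delete_last_col[OF A])
  then show "rank (delete_last_col A) \<le> rank A" "rank A \<le> Suc (rank (delete_last_col A))"
    by simp_all
qed

subsection \<open>Counting matrices of given rank\<close>

definition mats_of_rank :: "nat \<Rightarrow> nat \<Rightarrow> nat \<Rightarrow> 'a::field mat set" where
  "mats_of_rank m n r = {A \<in> carrier_mat m n. vec_space.rank m A = r}"

lemma finite_mats_of_rank: "finite (mats_of_rank m n r :: 'f::{field,finite} mat set)"
  by (simp add: mats_of_rank_def finite_carrier_mat)

lemma mats_of_rank_0: "mats_of_rank m n 0 = {0\<^sub>m m n}"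
  by (auto simp: mats_of_rank_def vec_space.rank_eq_0_iff vec_space.rank_0I)

lemma mats_of_rank_eq_empty: "n < r \<Longrightarrow> mats_of_rank m n r = {}"
  using vec_space.rank_le_nc leD unfolding mats_of_rank_def by blast

lemma bij_betw_append_col_mats_of_rank:
  "bij_betw (\<lambda>(A, v). append_col A v)
    ((SIGMA A:mats_of_rank m n (Suc r). vec_space.col_space m A) \<union>
     (SIGMA A:mats_of_rank m n r. carrier_vec m - vec_space.col_space m A))
    (mats_of_rank m (Suc n) (Suc r))"
  (is "bij_betw ?f ?D _")
proof (rule bij_betw_subset[OF bij_betw_append_col])
  have D: "?D = {p \<in> carrier_mat m n \<times> carrier_vec m. vec_space.rank m (?f p) = Suc r}"
  proof (rule Set.set_eqI)
    fix p :: "'a mat \<times> 'a vec"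
    obtain A v where p: "p = (A, v)"
      by (cases p)
    show "p \<in> ?D \<longleftrightarrow> p \<in> {p \<in> carrier_mat m n \<times> carrier_vec m. vec_space.rank m (?f p) = Suc r}"
    proof (cases "A \<in> carrier_mat m n \<and> v \<in> carrier_vec m")
      case True
      then show ?thesis
        using vec_space.rank_append_col[of A m n v] by (auto simp: p mats_of_rank_def)
    next
      case False
      then show ?thesis
        using vec_space.col_space_subset_carrier[of A m n] by (auto simp: p mats_of_rank_def)
    qed
  qed
  then show "?D \<subseteq> carrier_mat m n \<times> carrier_vec m"
    by blast
  have "?f ` ?D = {A \<in> ?f ` (carrier_mat m n \<times> carrier_vec m). vec_space.rank m A = Suc r}"
    unfolding D by blast
  then show "?f ` ?D = mats_of_rank m (Suc n) (Suc r)"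
    by (simp only: bij_betw_imp_surj_on[OF bij_betw_append_col] mats_of_rank_def)
qed

lemma card_mats_of_rank_Suc_Suc:
  fixes m n r :: nat
  defines "N \<equiv> \<lambda>n r. card (mats_of_rank m n r :: 'f::{field,finite} mat set)" and "q \<equiv> CARD('f)"
  shows "real (N (Suc n) (Suc r)) = real q ^ Suc r * N n (Suc r) + (real q ^ m - real q ^ r) * N n r"
proof -
  let ?M = "\<lambda>r. mats_of_rank m n r :: 'f mat set"
  let ?in = "SIGMA A:?M (Suc r). vec_space.col_space m A"
  let ?out = "SIGMA A:?M r. carrier_vec m - vec_space.col_space m A"
  have M: "A \<in> carrier_mat m n" "vec_space.rank m A = k" if "A \<in> ?M k" for A k
    using that by (simp_all add: mats_of_rank_def)
  have fin: "finite ?in" "finite ?out"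
    by (auto intro!: finite_SigmaI finite_mats_of_rank finite_col_space M(1))
  have "N (Suc n) (Suc r) = card (?in \<union> ?out)"
    unfolding N_def by (rule bij_betw_same_card[OF bij_betw_append_col_mats_of_rank, symmetric])
  also have "\<dots> = card ?in + card ?out"
    using fin by (rule card_Un_disjoint) (auto dest: M(2))
  also have "card ?in = (\<Sum>A\<in>?M (Suc r). card (vec_space.col_space m A))"
    by (intro card_SigmaI) (auto simp: finite_mats_of_rank intro: finite_col_space M(1))
  also have "\<dots> = q ^ Suc r * N n (Suc r)"
    using card_col_space[OF M(1)] by (simp add: M(2) N_def q_def)
  also have "card ?out = (\<Sum>A\<in>?M r. card (carrier_vec m - vec_space.col_space m A))"
    by (intro card_SigmaI) (auto simp: finite_mats_of_rank)
  finally have "real (N (Suc n) (Suc r)) = real q ^ Suc r * N n (Suc r)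
      + (\<Sum>A\<in>?M r. real (card (carrier_vec m - vec_space.col_space m A)))"
    by simp
  also have "(\<Sum>A\<in>?M r. real (card (carrier_vec m - vec_space.col_space m A)))
      = (real q ^ m - real q ^ r) * N n r"
    using card_carrier_vec_minus_col_space[OF M(1)] by (simp add: M(2) N_def q_def)
  finally show ?thesis .
qed

definition q_falling :: "nat \<Rightarrow> nat \<Rightarrow> nat \<Rightarrow> real" where
  "q_falling q n k = (\<Prod>i<k. real q ^ n - real q ^ i)"

lemma q_falling_Suc: "q_falling q n (Suc k) = q_falling q n k * (real q ^ n - real q ^ k)"
  by (simp add: q_falling_def)

lemma q_falling_Suc_Suc:
  "q_falling q (Suc n) (Suc k) = (real q ^ Suc n - 1) * real q ^ k * q_falling q n k"
proof -
  have "q_falling q (Suc n) (Suc k)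
      = (real q ^ Suc n - 1) * (\<Prod>i<k. real q * (real q ^ n - real q ^ i))"
    unfolding q_falling_def prod.lessThan_Suc_shift by (simp add: algebra_simps)
  then show ?thesis
    by (simp add: q_falling_def prod.distrib)
qed

lemma q_falling_eq_0: "n < k \<Longrightarrow> q_falling q n k = 0"
  unfolding q_falling_def by (rule prod_zero) auto

lemma q_falling_self_neq_0: "2 \<le> q \<Longrightarrow> q_falling q k k \<noteq> 0"
  unfolding q_falling_def by (auto simp: power_inject_exp)

lemma q_falling_self_eq_q_fact:
  assumes q: "2 \<le> q"
  shows "q_falling q r r = real q ^ (r choose 2) * (real q - 1) ^ r * q_fact q r"
proof (induction r)
  case 0
  then show ?case
    by (simp add: q_fact_def q_falling_def binomial_eq_0)
next
  case (Suc r)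
  have "Suc r choose 2 = r + (r choose 2)"
    by (simp add: numeral_2_eq_2)
  moreover have "real q ^ Suc r - 1 = (real q - 1) * q_int q (Suc r)"
    using q by (simp add: q_int_def)
  moreover have "q_fact q (Suc r) = q_fact q r * q_int q (Suc r)"
    by (simp add: q_fact_def)
  ultimately show ?case
    by (simp only: q_falling_Suc_Suc Suc.IH power_add power_Suc mult_ac)
qed

lemma q_binomial_eq_q_falling: "q_binomial q n k = q_falling q n k / q_falling q k k"
  by (simp add: q_binomial_def q_falling_def prod_dividef)

lemma q_binomial_0_right: "q_binomial q n 0 = 1"
  by (simp add: q_binomial_def)

lemma q_binomial_eq_0: "n < k \<Longrightarrow> q_binomial q n k = 0"
  by (simp add: q_binomial_eq_q_falling q_falling_eq_0)

lemma q_binomial_Suc_Suc: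
  assumes q: "2 \<le> q"
  shows "q_binomial q (Suc n) (Suc k) = real q ^ Suc k * q_binomial q n (Suc k) + q_binomial q n k"
proof -
  let ?D = "(real q ^ Suc k - 1) * real q ^ k"
  have "1 < real q ^ Suc k"
    using q by (intro one_less_power) auto
  then have "?D \<noteq> 0"
    using q by simp
  then have cancel: "q_falling q n k * ?D / (?D * q_falling q k k) = q_falling q n k / q_falling q k k"
    by simp
  have "(real q ^ Suc n - 1) * real q ^ k * q_falling q n k
      = real q ^ Suc k * (q_falling q n k * (real q ^ n - real q ^ k)) + q_falling q n k * ?D"
    by (simp add: algebra_simps)
  then have "q_binomial q (Suc n) (Suc k)
      = real q ^ Suc k * q_binomial q n (Suc k) + q_falling q n k * ?D / (?D * q_falling q k k)"
    unfolding q_binomial_eq_q_falling q_falling_Suc_Suc q_falling_Suc[of q n]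
    by (simp only: add_divide_distrib times_divide_eq_right)
  then show ?thesis
    unfolding cancel q_binomial_eq_q_falling[symmetric] .
qed

lemma CARD_field_ge_2: "2 \<le> CARD('f::{field,finite})"
  using card_mono[of "UNIV :: 'f set" "{0, 1}"] by simp

theorem card_mats_of_rank:
  "real (card (mats_of_rank m n r :: 'f::{field,finite} mat set))
    = q_falling CARD('f) m r * q_binomial CARD('f) n r"
proof (induction n arbitrary: r)
  case 0
  show ?case
    by (cases r) (simp_all add: mats_of_rank_0 mats_of_rank_eq_empty q_falling_def
        q_binomial_0_right q_binomial_eq_0)
next
  case (Suc n)
  show ?case
  proof (cases r)
    case 0
    then show ?thesis
      by (simp add: mats_of_rank_0 q_falling_def q_binomial_0_right)
  next
    case (Suc k)
    then show ?thesis
      by (simp add: card_mats_of_rank_Suc_Suc Suc.IH q_binomial_Suc_Suc[OF CARD_field_ge_2]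
          q_falling_Suc algebra_simps)
  qed
qed

subsection \<open>Bounds on rank codes\<close>

lemma Lambda_leI:
  assumes "\<And>C. C \<in> rank_codes F a b d u \<Longrightarrow> inj_on f C"
    and "\<And>C. C \<in> rank_codes F a b d u \<Longrightarrow> f ` C \<in> rank_codes F a' b' d' u'"
  shows "Lambda F a b d u \<le> Lambda F a' b' d' u'"
proof -
  obtain C where "C \<in> rank_codes F a b d u" "card C = Lambda F a b d u"
    using Lambda_attained by blast
  then show ?thesis
    using card_le_Lambda[OF assms(2)] card_image[OF assms(1)] by metis
qed

lemma inj_on_delete_last_col:
  assumes C: "C \<in> rank_codes F a (Suc b) d u" and d: "2 \<le> d"
  shows "inj_on delete_last_col C"
proof (rule inj_onI, rule ccontr)
  fix X Y assume XY: "X \<in> C" "Y \<in> C" "delete_last_col X = delete_last_col Y" "X \<noteq> Y"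
  have carrier: "X \<in> carrier_mat a (Suc b)" "Y \<in> carrier_mat a (Suc b)"
    using XY(1,2) C by (auto simp: rank_codes_def)
  have "delete_last_col (X - Y) = 0\<^sub>m a b"
    using delete_last_col_minus[OF carrier] XY(3) delete_last_col_carrier[OF carrier(2)] by simp
  then have "vec_space.rank a (X - Y) \<le> 1"
    using vec_space.rank_delete_last_col_bounds(2)[of "X - Y" a b] carrier
    by (simp add: vec_space.rank_0I minus_carrier_mat)
  then show False
    using C XY d by (force simp: rank_codes_def)
qed

lemma rank_codes_delete_last_col:
  assumes C: "C \<in> rank_codes F a (Suc b) (Suc d) u"
  shows "delete_last_col ` C \<in> rank_codes F a b d u"
proof -
  have carrier: "X \<in> carrier_mat a (Suc b)" and rank: "vec_space.rank a X \<le> u" if "X \<in> C" for X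
    using that C by (auto simp: rank_codes_def)
  have "d \<le> vec_space.rank a (delete_last_col X - delete_last_col Y)"
    if "X \<in> C" "Y \<in> C" "X \<noteq> Y" for X Y
  proof -
    have "Suc d \<le> vec_space.rank a (X - Y)"
      using that C by (auto simp: rank_codes_def)
    also have "\<dots> \<le> Suc (vec_space.rank a (delete_last_col (X - Y)))"
      using carrier[OF that(2)] by (intro vec_space.rank_delete_last_col_bounds(2) minus_carrier_mat)
    finally show ?thesis
      using delete_last_col_minus[OF carrier carrier, OF that(1,2)] by simp
  qed
  moreover have "vec_space.rank a (delete_last_col X) \<le> u" if "X \<in> C" for X
    using vec_space.rank_delete_last_col_bounds(1)[OF carrier] rank that order_trans by blast
  ultimately show ?thesis
    using carrier by (auto simp: rank_codes_def)
qed

lemma Lambda_delete_col: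
  assumes "1 \<le> d"
  shows "Lambda F a (Suc b) (Suc d) u \<le> Lambda F a b d u"
  using assms by (intro Lambda_leI[where f = delete_last_col] inj_on_delete_last_col
      rank_codes_delete_last_col) auto

lemma Lambda_delete_cols:
  assumes "1 \<le> d"
  shows "Lambda F a (b + k) (d + k) u \<le> Lambda F a b d u"
proof (induction k)
  case (Suc k)
  have "Lambda F a (b + Suc k) (d + Suc k) u \<le> Lambda F a (b + k) (d + k) u"
    using assms Lambda_delete_col[of "d + k"] by simp
  then show ?case
    using Suc by (rule order_trans)
qed simp

lemma rank_codes_transpose:
  assumes C: "C \<in> rank_codes F a b d u"
  shows "transpose_mat ` C \<in> rank_codes F b a d u"
proof -
  have carrier: "X \<in> carrier_mat a b" if "X \<in> C" for X
    using that C by (auto simp: rank_codes_def)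
  have "vec_space.rank b (X\<^sup>T - Y\<^sup>T) = vec_space.rank a (X - Y)" if "X \<in> C" "Y \<in> C" for X Y
    using rank_transpose[of "X - Y" a b] transpose_minus[OF carrier carrier, OF that] carrier that
    by (simp add: minus_carrier_mat)
  moreover have "vec_space.rank b X\<^sup>T = vec_space.rank a X" if "X \<in> C" for X
    by (rule rank_transpose[OF carrier[OF that]])
  ultimately show ?thesis
    using C carrier by (auto simp: rank_codes_def)
qed

lemma Lambda_transpose: "Lambda F a b d u = Lambda F b a d u"
proof -
  have "Lambda F a b d u \<le> Lambda F b a d u" for a b
    by (rule Lambda_leI[where f = transpose_mat]) (auto simp: rank_codes_transpose inj_on_def)
  then show ?thesis
    by (intro antisym)
qed

lemma Lambda_le_sum_card_mats_of_rank:
  "Lambda (F :: 'f::{field,finite} itself) a b d u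
    \<le> (\<Sum>r = 0..min u b. card (mats_of_rank a b r :: 'f mat set))"
proof -
  obtain C :: "'f mat set" where C: "C \<in> rank_codes F a b d u" "card C = Lambda F a b d u"
    using Lambda_attained by blast
  have "vec_space.rank a X \<le> min u b" "X \<in> carrier_mat a b" if "X \<in> C" for X
    using that C(1) vec_space.rank_le_nc[of X a b] by (auto simp: rank_codes_def)
  then have "C \<subseteq> (\<Union>r\<in>{0..min u b}. mats_of_rank a b r)"
    by (auto simp: mats_of_rank_def)
  then have "card C \<le> card (\<Union>r\<in>{0..min u b}. mats_of_rank a b r :: 'f mat set)"
    by (intro card_mono) (simp_all add: finite_mats_of_rank)
  also have "\<dots> \<le> (\<Sum>r = 0..min u b. card (mats_of_rank a b r :: 'f mat set))"
    by (rule card_UN_le) simp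
  finally show ?thesis
    using C(2) by simp
qed

lemma Lambda_le_sum_q_binomial:
  fixes F :: "'f::{field,finite} itself"
  assumes q: "CARD('f) = q" and d: "1 \<le> d" "d \<le> b"
  shows "real (Lambda F a b d u) \<le> (\<Sum>r = 0..min u (b - d + 1).
    real q ^ (r choose 2) * (real q - 1) ^ r * q_fact q r
    * q_binomial q (b - d + 1) r * q_binomial q a r)"
proof -
  define c where "c = b - d + 1"
  have "Lambda F a b d u \<le> Lambda F a c 1 u"
    using Lambda_delete_cols[of 1 F a c "d - 1" u] d by (simp add: c_def)
  also have "\<dots> \<le> (\<Sum>r = 0..min u c. card (mats_of_rank a c r :: 'f mat set))"
    by (rule Lambda_le_sum_card_mats_of_rank)
  finally have "real (Lambda F a b d u)
      \<le> (\<Sum>r = 0..min u c. real (card (mats_of_rank a c r :: 'f mat set)))"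
    by (simp flip: of_nat_sum)
  also have "\<dots> = (\<Sum>r = 0..min u c. q_falling q r r * q_binomial q c r * q_binomial q a r)"
    using q_falling_self_neq_0[OF CARD_field_ge_2[where 'f = 'f]]
    by (simp add: card_mats_of_rank q q_binomial_eq_q_falling[of q a] mult.commute)
  finally show ?thesis
    using CARD_field_ge_2[where 'f = 'f] by (simp add: q q_falling_self_eq_q_fact c_def)
qed

theorem theorem9:
  fixes q a b d u :: nat
  assumes "primepow q" and "CARD('f::{field,finite}) = q"
    and "2 \<le> d" and "d \<le> min a b"
  shows "Lambda TYPE('f) a b d u \<le> Lambda TYPE('f) a (b - 1) (d - 1) u
    \<and> real (Lambda TYPE('f) a b d u) \<le>
      (\<Sum>r = 0..min u (min a b - d + 1).
        real q ^ (r choose 2) * (real q - 1) ^ r * q_fact q r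
        * q_binomial q (min a b - d + 1) r * q_binomial q (max a b) r)"
proof
  show "Lambda TYPE('f) a b d u \<le> Lambda TYPE('f) a (b - 1) (d - 1) u"
    using Lambda_delete_col[of "d - 1" "TYPE('f)" a "b - 1" u] assms(3,4) by simp
  have "Lambda TYPE('f) a b d u = Lambda TYPE('f) (max a b) (min a b) d u"
    using Lambda_transpose[of "TYPE('f)" a b d u] by (cases "a \<le> b") simp_all
  then show "real (Lambda TYPE('f) a b d u) \<le>
      (\<Sum>r = 0..min u (min a b - d + 1).
        real q ^ (r choose 2) * (real q - 1) ^ r * q_fact q r
        * q_binomial q (min a b - d + 1) r * q_binomial q (max a b) r)"
    using Lambda_le_sum_q_binomial[OF assms(2), of d "min a b"] assms(3,4) by simp
qed

end
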